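(* Let $N\ge 1$ and $n\ge 0$ be integers and let $\{\mathbf{a}_0,\ldots,\mathbf{a}_n\}\subset\mathbb{R}^N$ be geometrically independent. Then the $n$-simplex $\sigma_n$ spanned by $\mathbf{a}_0,\ldots,\mathbf{a}_n$ is a convex subset of $\mathbb{R}^N$.
   Context: Points $\mathbf{a}_0,\ldots,\mathbf{a}_n$ of $\mathbb{R}^N$ are geometrically independent if for all real scalars $t_i$, the equations $\sum_{i=0}^n t_i=0$ and $\sum_{i=0}^n t_i\mathbf{a}_i=\mathbf{0}$ imply $t_i=0$ for all $i$. The $n$-simplex spanned by such points is $\sigma_n=\{\sum_{i=0}^n t_i\mathbf{a}_i : t_i\ge 0,\ \sum_{i=0}^n t_i=1\}$. *)

theory Defs
  imports "HOL-Analysis.Analysis"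
begin

(* The points are a 0, ..., a n; the values of a at indices above n are irrelevant.
   Since the condition is on the indexed family, it makes the a i pairwise distinct for i \<le> n. *)
definition geometrically_independent :: "nat \<Rightarrow> (nat \<Rightarrow> real ^ 'N) \<Rightarrow> bool" where
  "geometrically_independent n a \<longleftrightarrow>
     (\<forall>t :: nat \<Rightarrow> real. (\<Sum>i=0..n. t i) = 0 \<and> (\<Sum>i=0..n. t i *\<^sub>R a i) = 0
        \<longrightarrow> (\<forall>i\<in>{0..n}. t i = 0))"

definition simplex_spanned :: "nat \<Rightarrow> (nat \<Rightarrow> real ^ 'N) \<Rightarrow> (real ^ 'N) set" where
  "simplex_spanned n a =
     {(\<Sum>i=0..n. t i *\<^sub>R a i) | t :: nat \<Rightarrow> real.
        (\<forall>i\<in>{0..n}. 0 \<le> t i) \<and> (\<Sum>i=0..n. t i) = 1}"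

end

theory Submission
  imports Defs
begin

text \<open>The simplex is the image of the set of nonnegative weight functions of total 1 under the
  map sending \<open>t\<close> to the sum of the \<open>t i *\<^sub>R a i\<close>. That map is
  linear and both conditions on the weights survive convex combinations, so it suffices to mix the
  weights of two points.\<close>

theorem theorem3p14:
  fixes n :: nat and a :: "nat \<Rightarrow> real ^ 'N"
  assumes "geometrically_independent n a"
  shows "convex (simplex_spanned n a)"
proof (rule convexI)
  fix x y and u v :: real
  assume "x \<in> simplex_spanned n a" "y \<in> simplex_spanned n a"
  then obtain s t
    where x: "x = (\<Sum>i=0..n. s i *\<^sub>R a i)" and s: "\<forall>i\<in>{0..n}. 0 \<le> s i" "(\<Sum>i=0..n. s i) = 1"
      and y: "y = (\<Sum>i=0..n. t i *\<^sub>R a i)" and t: "\<forall>i\<in>{0..n}. 0 \<le> t i" "(\<Sum>i=0..n. t i) = 1"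
    unfolding simplex_spanned_def by blast
  assume uv: "0 \<le> u" "0 \<le> v" "u + v = 1"
  \<comment> \<open>Mixing weights pointwise with the same \<open>u\<close> and \<open>v\<close>
    gives the witness for membership.\<close>
  define r where "r i = u * s i + v * t i" for i
  have "u *\<^sub>R x + v *\<^sub>R y = (\<Sum>i=0..n. r i *\<^sub>R a i)"
    by (simp add: x y r_def scaleR_sum_right scaleR_left_distrib sum.distrib)
  moreover have "\<forall>i\<in>{0..n}. 0 \<le> r i"
    using s(1) t(1) uv by (simp add: r_def)
  moreover have "(\<Sum>i=0..n. r i) = 1"
    \<comment> \<open>The flipped rule pulls \<open>u\<close> and \<open>v\<close> out of the sums,
      so the total becomes \<open>u * 1 + v * 1\<close>.\<close>
    using s(2) t(2) uv(3) by (simp add: r_def sum.distrib flip: sum_distrib_left)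
  ultimately show "u *\<^sub>R x + v *\<^sub>R y \<in> simplex_spanned n a"
    unfolding simplex_spanned_def by blast
qed

end
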